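(* Let $G=\mathbb{Z}_n$, $2\le k\le n-1$, and $x_1,x_2\in G$. If $\gcd(x_1,n)=\gcd(x_2,n)$, then $(G,\mathcal{B}_k^{x_1})$ and $(G,\mathcal{B}_k^{x_2})$ are either both $1$-designs or neither is a $1$-design.
   Context: $\mathcal{B}_k^x$ is the family of all $k$-subsets of $\mathbb{Z}_n$ whose elements sum to $x$; $(G,\mathcal{B}_k^x)$ is a $1$-design if every element of $G$ lies in the same number of these subsets. Elements of $\mathbb{Z}_n$ are identified with integer representatives for computing $\gcd$. *)

theory Defs
  imports "HOL-Number_Theory.Residues"
begin

definition sum_blocks :: "('a, 'b) ring_scheme \<Rightarrow> nat \<Rightarrow> 'a \<Rightarrow> 'a set set" where
  "sum_blocks G k x = {B. B \<subseteq> carrier G \<and> card B = k \<and> (\<Oplus>\<^bsub>G\<^esub>b\<in>B. b) = x}"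

definition one_design :: "'a set \<Rightarrow> 'a set set \<Rightarrow> bool" where
  "one_design V \<B> \<longleftrightarrow> (\<exists>r::nat. \<forall>v\<in>V. card {B \<in> \<B>. v \<in> B} = r)"

end

theory Submission
  imports Defs
begin

text \<open>Residues with the same gcd with \<open>n\<close> differ by a unit factor of the residue ring, and
  multiplication by a unit is an additive automorphism, hence maps the blocks with sum \<open>x\<close>
  bijectively to the blocks with sum \<open>u x\<close>.\<close>

text \<open>The blocks through \<open>f v\<close> in the image family are exactly the images of the
  blocks through \<open>v\<close>. Since \<open>\<A>\<close> lives in \<open>Pow V\<close>, where
  \<open>f\<close> is injective, taking images neither merges blocks nor adds incidences.\<close>

lemma one_design_image_iff:
  assumes f: "bij_betw f V V" and A: "\<A> \<subseteq> Pow V"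
  shows "one_design V ((`) f ` \<A>) \<longleftrightarrow> one_design V \<A>"
proof -
  have inj: "inj_on f V" and V: "f ` V = V"
    using f by (auto simp: bij_betw_def)
  have card: "card {B \<in> (`) f ` \<A>. f v \<in> B} = card {B \<in> \<A>. v \<in> B}" if "v \<in> V" for v
  proof -
    have mem: "f v \<in> f ` B \<longleftrightarrow> v \<in> B" if "B \<in> \<A>" for B
      using inj_on_image_mem_iff[OF inj \<open>v \<in> V\<close>] A that by auto
    have "{B \<in> (`) f ` \<A>. f v \<in> B} = (`) f ` {B \<in> \<A>. v \<in> B}"
      unfolding image_def[of "(`) f"] using mem by blast
    moreover have "inj_on ((`) f) {B \<in> \<A>. v \<in> B}"
      using A by (intro inj_on_subset[OF inj_on_image_Pow[OF inj]]) blast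
    ultimately show ?thesis
      by (simp add: card_image)
  qed
  have "(\<forall>w\<in>V. card {B \<in> (`) f ` \<A>. w \<in> B} = r) \<longleftrightarrow> (\<forall>v\<in>V. card {B \<in> \<A>. v \<in> B} = r)" for r
  proof -
    \<comment> \<open>Surjectivity of \<open>f\<close> lets every point \<open>w\<close> be written
      as \<open>f v\<close>, the form in which \<open>card\<close> applies.\<close>
    have "(\<forall>w\<in>V. card {B \<in> (`) f ` \<A>. w \<in> B} = r) \<longleftrightarrow>
        (\<forall>w\<in>f ` V. card {B \<in> (`) f ` \<A>. w \<in> B} = r)"
      by (simp only: V)
    also have "\<dots> \<longleftrightarrow> (\<forall>v\<in>V. card {B \<in> \<A>. v \<in> B} = r)"
      using card by (simp only: ball_simps cong: ball_cong)
    finally show ?thesis .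
  qed
  then show ?thesis
    by (simp add: one_design_def)
qed

lemma (in ring) bij_betw_Units_mult:
  assumes u: "u \<in> Units R"
  shows "bij_betw ((\<otimes>) u) (carrier R) (carrier R)"
proof (rule bij_betw_byWitness[where f' = "(\<otimes>) (inv u)"])
  show "\<forall>a\<in>carrier R. inv u \<otimes> (u \<otimes> a) = a" "\<forall>a\<in>carrier R. u \<otimes> (inv u \<otimes> a) = a"
    using u by (simp_all flip: m_assoc add: Units_closed)
qed (use u in auto)

text \<open>Distributivity pulls \<open>u\<close> out of the block sum, and a unit can be cancelled.
  Finiteness of the carrier makes every block a finite set, as distributivity over
  \<open>finsum\<close> requires.\<close>

lemma (in ring) sum_blocks_Units_mult:
  assumes u: "u \<in> Units R" and x: "x \<in> carrier R" and fin: "finite (carrier R)"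
  shows "sum_blocks R k (u \<otimes> x) = (`) ((\<otimes>) u) ` sum_blocks R k x"
proof -
  note bij = bij_betw_Units_mult[OF u]
  have inj: "inj_on ((\<otimes>) u) (carrier R)" and surj: "(\<otimes>) u ` carrier R = carrier R"
    using bij by (auto simp: bij_betw_def)
  have uR: "u \<in> carrier R"
    using u by (rule Units_closed)
  \<comment> \<open>An equivalence for arbitrary subsets serves both inclusions: the second one
    first writes a block \<open>C\<close> as an image, by surjectivity.\<close>
  have iff: "(\<otimes>) u ` B \<in> sum_blocks R k (u \<otimes> x) \<longleftrightarrow> B \<in> sum_blocks R k x"
    if B: "B \<subseteq> carrier R" for B
  proof -
    have injB: "inj_on ((\<otimes>) u) B"
      using inj B by (rule inj_on_subset)
    have sum: "(\<Oplus>b\<in>(\<otimes>) u ` B. b) = u \<otimes> (\<Oplus>b\<in>B. b)"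
    proof -
      have "(\<Oplus>b\<in>(\<otimes>) u ` B. b) = (\<Oplus>b\<in>B. u \<otimes> b)"
        using B uR injB by (intro finsum_reindex) auto
      also have "\<dots> = u \<otimes> (\<Oplus>b\<in>B. b)"
        using B uR finite_subset[OF B fin] by (subst finsum_rdistr) auto
      finally show ?thesis .
    qed
    have "(\<Oplus>b\<in>B. b) \<in> carrier R"
      using B by (intro finsum_closed) auto
    then have "u \<otimes> (\<Oplus>b\<in>B. b) = u \<otimes> x \<longleftrightarrow> (\<Oplus>b\<in>B. b) = x"
      using inj_on_eq_iff[OF inj] x by blast
    moreover have "(\<otimes>) u ` B \<subseteq> carrier R"
      using B uR by auto
    ultimately show ?thesis
      using B by (simp add: sum_blocks_def sum card_image[OF injB])
  qed
  show ?thesis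
  proof
    show "(`) ((\<otimes>) u) ` sum_blocks R k x \<subseteq> sum_blocks R k (u \<otimes> x)"
      using iff by (auto simp: sum_blocks_def)
    show "sum_blocks R k (u \<otimes> x) \<subseteq> (`) ((\<otimes>) u) ` sum_blocks R k x"
    proof
      fix C assume C: "C \<in> sum_blocks R k (u \<otimes> x)"
      then have "C \<subseteq> (\<otimes>) u ` carrier R"
        by (simp add: surj sum_blocks_def)
      then obtain B where "B \<subseteq> carrier R" "C = (\<otimes>) u ` B"
        by (auto simp: subset_image_iff)
      with C iff show "C \<in> (`) ((\<otimes>) u) ` sum_blocks R k x"
        by blast
    qed
  qed
qed

corollary (in ring) one_design_sum_blocks_Units_mult:
  assumes "u \<in> Units R" and "x \<in> carrier R" and "finite (carrier R)"
  shows "one_design (carrier R) (sum_blocks R k (u \<otimes> x)) \<longleftrightarrow>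
         one_design (carrier R) (sum_blocks R k x)"
  unfolding sum_blocks_Units_mult[OF assms]
  using bij_betw_Units_mult[OF assms(1)]
  by (rule one_design_image_iff) (auto simp: sum_blocks_def)

text \<open>For \<open>m\<close> dividing \<open>n\<close> this is the surjectivity of reduction
  from the units modulo \<open>n\<close> to the units modulo \<open>m\<close>.\<close>

lemma ex_coprime_lift:
  fixes u m n :: int
  assumes cop: "coprime u m" and n: "n \<noteq> 0"
  shows "\<exists>t. coprime (u + m * t) n"
proof -
  text \<open>Each prime factor of \<open>n\<close> will divide exactly one of \<open>u\<close> and \<open>m * t\<close>.\<close>
  define P where "P = {p \<in> prime_factors n. \<not> p dvd u}"
  define t where "t = \<Prod>P"
  have finP: "finite P"
    by (simp add: P_def)
  have "\<not> p dvd u + m * t" if p: "prime p" "p dvd n" for p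
  proof (cases "p dvd u")
    case True
    then have "\<not> p dvd m"
      using cop p(1) by (meson coprime_common_divisor not_prime_unit)
    moreover have "\<not> p dvd t"
    proof
      assume "p dvd t"
      then obtain q where q: "q \<in> P" "p dvd q"
        using p(1) finP by (auto simp: t_def prime_dvd_prod_iff)
      then have "p = q"
        using p(1) primes_dvd_imp_eq by (auto simp: P_def in_prime_factors_iff)
      with q True show False
        by (simp add: P_def)
    qed
    ultimately show ?thesis
      using True p(1) by (simp add: dvd_add_right_iff prime_dvd_mult_iff)
  next
    case False
    then have "p \<in> P"
      using p n by (simp add: P_def in_prime_factors_iff)
    then have "p dvd t"
      unfolding t_def using finP by (rule dvd_prodI[rotated])
    then show ?thesis
      using False by (simp add: dvd_add_left_iff)
  qed
  then have "coprime (u + m * t) n"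
  proof (intro coprimeI)
    fix c assume no: "\<And>p. prime p \<Longrightarrow> p dvd n \<Longrightarrow> \<not> p dvd u + m * t"
      and c: "c dvd u + m * t" "c dvd n"
    have "c \<noteq> 0"
      using c(2) n by auto
    then show "is_unit c"
      using no c prime_divisorE dvd_trans by meson
  qed
  then show ?thesis ..
qed

text \<open>After division by the common gcd \<open>d\<close>, the cofactors \<open>a\<close> and
  \<open>b\<close> are units modulo \<open>m = n / d\<close>, so their quotient carries
  \<open>a\<close> to \<open>b\<close> there. It is then lifted to a unit modulo
  \<open>n\<close>.\<close>

lemma gcd_eq_imp_cong_unit_mult:
  fixes x y n :: int
  assumes gcd: "gcd x n = gcd y n" and n: "n \<noteq> 0"
  shows "\<exists>u. coprime u n \<and> [u * x = y] (mod n)"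
proof -
  define d where "d = gcd x n"
  have d: "d \<noteq> 0"
    using n by (simp add: d_def)
  obtain a m where a: "x = a * d" "n = m * d" "coprime a m"
    using gcd_coprime_exists[OF d[unfolded d_def]] unfolding d_def by blast
  obtain b where b: "y = b * d" "coprime b m"
  proof -
    obtain b m' where "y = b * d" "n = m' * d" "coprime b m'"
      using gcd_coprime_exists[OF d[unfolded d_def gcd]] unfolding d_def gcd by blast
    \<comment> \<open>Cancelling \<open>d\<close> in the two factorizations of \<open>n\<close>
      gives \<open>m' = m\<close>.\<close>
    with a(2) d that show thesis
      by simp
  qed
  obtain a' where a': "[a * a' = 1] (mod m)"
    using a(3) cong_solve_coprime_int by blast
  have "coprime (a * a') m"
    using cong_imp_coprime[OF cong_sym[OF a']] by simp
  then have "coprime (a' * b) m"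
    using b(2) by simp
  then obtain t where t: "coprime (a' * b + m * t) n"
    using ex_coprime_lift n by blast
  have "[(a' * b + m * t) * a = (a * a') * b] (mod m)"
    by (simp add: cong_iff_dvd_diff algebra_simps)
  also have "[(a * a') * b = 1 * b] (mod m)"
    using a' by (rule cong_scalar_right)
  \<comment> \<open>Scaling by \<open>d\<close> turns a congruence modulo \<open>m\<close> into one
    modulo \<open>m * d = n\<close>.\<close>
  finally have "[(a' * b + m * t) * x = y] (mod n)"
    unfolding a b mult.assoc[symmetric] using d
    by (simp add: cong_iff_dvd_diff flip: left_diff_distrib)
  with t show ?thesis
    by blast
qed

theorem theorem5:
  fixes n k :: nat and x\<^sub>1 x\<^sub>2 :: int
  defines "G \<equiv> residue_ring (int n)"
  assumes "2 \<le> k" and "k \<le> n - 1"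
    and "x\<^sub>1 \<in> carrier G" and "x\<^sub>2 \<in> carrier G"
    and "gcd x\<^sub>1 (int n) = gcd x\<^sub>2 (int n)"
  shows "one_design (carrier G) (sum_blocks G k x\<^sub>1) \<longleftrightarrow>
         one_design (carrier G) (sum_blocks G k x\<^sub>2)"
proof -
  have n: "1 < int n"
    using assms(2,3) by linarith
  interpret residues "int n" G
    using n by unfold_locales (simp_all add: G_def)
  obtain u where u: "coprime u (int n)" "[u * x\<^sub>1 = x\<^sub>2] (mod int n)"
    using gcd_eq_imp_cong_unit_mult[OF assms(6)] n by auto
  \<comment> \<open>The carrier consists of the representatives from 0 to \<open>n - 1\<close>, so
    \<open>u\<close> is reduced to lie in it.\<close>
  define v where "v = u mod int n"
  have "coprime v (int n)"
    using u(1) n by (simp add: v_def coprime_mod_left_iff)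
  moreover have "0 \<le> v" "v < int n"
    using n by (simp_all add: v_def)
  \<comment> \<open>Zero is not coprime to \<open>n\<close>, because \<open>n\<close> exceeds
    1.\<close>
  moreover have "v \<noteq> 0"
    using n \<open>coprime v (int n)\<close> by auto
  ultimately have "v \<in> Units G"
    by (simp add: res_units_eq)
  moreover have "v \<otimes>\<^bsub>G\<^esub> x\<^sub>1 = x\<^sub>2"
    using u(2) assms(5) by (simp add: v_def res_mult_eq res_carrier_eq cong_def mod_mult_left_eq)
  ultimately show ?thesis
    using one_design_sum_blocks_Units_mult[of v x\<^sub>1 k] assms(4) by (simp add: res_carrier_eq)
qed

end
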